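(* Let $T$ be the infinite complete $k$-ary tree with $k \ge 2$ (a rooted tree in which every vertex has exactly $k$ children; the root has degree $k$ and every other vertex degree $k+1$). Then the minimum density of a RED:LD set in $T$ is $\frac{2}{k+2}$.
   Context: $N(v)$ denotes the open neighborhood of $v$. A set $S \subseteq V(G)$ is a locating-dominating (LD) set if for all $u,v \in V(G)-S$: $N(v)\cap S \neq \varnothing$, and if $u \ne v$ then $N(v) \cap S \neq N(u) \cap S$. A RED:LD set is an LD set $S$ such that $S-\{v\}$ is an LD set for every $v \in S$. For an infinite graph, the density of a vertex set $S$ is the ratio of $|S|$ to $|V(G)|$ (in the usual limiting sense), and the minimum density over RED:LD sets is denoted $\textrm{RED:LD}\%(G)$. *)

theory Defs
  imports "Graph_Theory.Graph_Theory" "HOL-Analysis.Analysis"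
begin

text \<open>A simple graph, possibly infinite, is a symmetric loop-free digraph in the sense of
  \<^locale>\<open>pair_bidirected_digraph\<close>: every edge is represented by its two arcs.\<close>

definition open_nbhd :: "'a pair_pre_digraph \<Rightarrow> 'a \<Rightarrow> 'a set" where
  "open_nbhd G v = {u. (v, u) \<in> parcs G}"

definition LD_set :: "'a pair_pre_digraph \<Rightarrow> 'a set \<Rightarrow> bool" where
  "LD_set G S \<longleftrightarrow> S \<subseteq> pverts G \<and>
     (\<forall>u \<in> pverts G - S. \<forall>v \<in> pverts G - S.
        open_nbhd G v \<inter> S \<noteq> {} \<and>
        (u \<noteq> v \<longrightarrow> open_nbhd G v \<inter> S \<noteq> open_nbhd G u \<inter> S))"

definition RED_LD_set :: "'a pair_pre_digraph \<Rightarrow> 'a set \<Rightarrow> bool" where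
  "RED_LD_set G S \<longleftrightarrow> LD_set G S \<and> (\<forall>v \<in> S. LD_set G (S - {v}))"

definition graph_ball :: "'a pair_pre_digraph \<Rightarrow> 'a \<Rightarrow> nat \<Rightarrow> 'a set" where
  "graph_ball G v r = {u \<in> pverts G. \<exists>n \<le> r. (v, u) \<in> parcs G ^^ n}"

text \<open>The density of \<open>S\<close> in a connected, locally finite graph, measured along the balls around
  \<open>v\<close>. The upper limit makes it defined for every \<open>S\<close>.\<close>

definition density_at :: "'a pair_pre_digraph \<Rightarrow> 'a \<Rightarrow> 'a set \<Rightarrow> ereal" where
  "density_at G v S =
     limsup (\<lambda>r. ereal (real (card (S \<inter> graph_ball G v r)) / real (card (graph_ball G v r))))"

text \<open>Vertices are the finite words over \<open>{0,\<dots>,k - 1}\<close>; the root is the empty word and the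
  children of \<open>w\<close> are the words \<open>i # w\<close>.\<close>

definition kary_tree :: "nat \<Rightarrow> nat list pair_pre_digraph" where
  "kary_tree k =
     \<lparr> pverts = lists {..<k},
       parcs = {(u, v). u \<in> lists {..<k} \<and> v \<in> lists {..<k} \<and> (\<exists>i. v = i # u \<or> u = i # v)} \<rparr>"

lemma kary_tree_simple_graph: "pair_bidirected_digraph (kary_tree k)"
proof
  show "symmetric (with_proj (kary_tree k))"
    by (auto simp: symmetric_def kary_tree_def intro!: symI)
qed (auto simp: kary_tree_def)

lemma kary_tree_root_degree: "card (open_nbhd (kary_tree k) []) = k"
proof -
  have "open_nbhd (kary_tree k) [] = (\<lambda>i. [i]) ` {..<k}"
    by (auto simp: open_nbhd_def kary_tree_def)
  then show ?thesis
    by (simp add: card_image inj_on_def)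
qed

lemma kary_tree_degree:
  assumes "w \<in> pverts (kary_tree k)" "w \<noteq> []"
  shows "card (open_nbhd (kary_tree k) w) = k + 1"
proof -
  obtain j u where w: "w = j # u" using assms(2) by (cases w) auto
  have "open_nbhd (kary_tree k) w = insert u ((\<lambda>i. i # w) ` {..<k})"
    using assms w by (auto simp: open_nbhd_def kary_tree_def)
  moreover have "u \<notin> (\<lambda>i. i # w) ` {..<k}"
    using w by (auto dest: arg_cong[of _ _ length])
  ultimately show ?thesis
    by (simp add: card_image inj_on_def)
qed

end

theory Submission
  imports Defs "HOL-Library.Sublist"
begin

text \<open>A set \<open>S\<close> in a \<open>k\<close>-ary tree is RED:LD iff every vertex outside \<open>S\<close> has at least two
  neighbours in \<open>S\<close> and every vertex of \<open>S\<close> at least one: separation is automatic because a tree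
  has no triangles and no 4-cycles. Let \<open>A r\<close> and \<open>b r\<close> count \<open>S\<close> and all vertices in the ball
  of radius \<open>r\<close> around \<open>v\<close>. Counting the edges between \<open>S\<close> and the ball of radius \<open>r + 1\<close> in
  two ways gives \<open>A (r + 2) + A (r + 1) + k * A r \<ge> 2 * b (r + 1)\<close>, and for the set of all
  vertices \<open>b (r + 2) + k * b r = (k + 1) * b (r + 1)\<close> once the root lies in the ball of radius
  \<open>r\<close>. Hence \<open>f r = A r - 2 / (k + 2) * b r\<close> satisfies \<open>f (r + 2) + f (r + 1) + k * f r \<ge> 0\<close>, so
  \<open>f\<close> cannot be negative from some point on. For the upper bound, a set in which those
  neighbour counts are attained exactly turns this into a linear recurrence whose characteristic
  roots have modulus \<open>sqrt k\<close>, while \<open>b r \<ge> k ^ r\<close>.\<close>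

subsection \<open>Neighbourhoods in the tree\<close>

abbreviation nbhd :: "nat \<Rightarrow> nat list \<Rightarrow> nat list set" where
  "nbhd k u \<equiv> open_nbhd (kary_tree k) u"

lemma pverts_kary_tree [simp]: "pverts (kary_tree k) = lists {..<k}"
  by (simp add: kary_tree_def)

lemma mem_nbhd_iff:
  "w \<in> nbhd k u \<longleftrightarrow> u \<in> lists {..<k} \<and> w \<in> lists {..<k} \<and> (\<exists>i. w = i # u \<or> u = i # w)"
  by (auto simp: open_nbhd_def kary_tree_def)

lemma nbhd_sym: "w \<in> nbhd k u \<longleftrightarrow> u \<in> nbhd k w"
  by (auto simp: mem_nbhd_iff)

lemma nbhd_subset: "nbhd k u \<subseteq> lists {..<k}"
  by (auto simp: mem_nbhd_iff)

lemma nbhd_Nil: "nbhd k [] = (\<lambda>i. [i]) ` {..<k}"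
  by (auto simp: mem_nbhd_iff)

lemma nbhd_Cons:
  assumes "j # t \<in> lists {..<k}"
  shows "nbhd k (j # t) = insert t ((\<lambda>i. i # j # t) ` {..<k})"
  using assms by (auto simp: mem_nbhd_iff)

lemma finite_nbhd [simp]: "finite (nbhd k u)"
proof (cases "u \<in> lists {..<k}")
  case True
  then show ?thesis by (cases u) (auto simp: nbhd_Nil nbhd_Cons)
next
  case False
  then have "nbhd k u = {}" by (auto simp: mem_nbhd_iff)
  then show ?thesis by simp
qed

lemma card_nbhd:
  "u \<in> lists {..<k} \<Longrightarrow> card (nbhd k u) + of_bool (u = []) = k + 1"
  using kary_tree_degree[of u k] kary_tree_root_degree[of k] by auto

lemma no_loop: "u \<notin> nbhd k u"
  by (auto simp: mem_nbhd_iff)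

lemma no_triangle: "x \<in> nbhd k u \<Longrightarrow> y \<in> nbhd k u \<Longrightarrow> x \<notin> nbhd k y"
  by (auto simp: mem_nbhd_iff dest: arg_cong[of _ _ length])

text \<open>In a 4-cycle the longest word would have two distinct shorter neighbours, but its tail
  is the only one.\<close>

lemma no_4_cycle:
  "x \<in> nbhd k u \<Longrightarrow> x \<in> nbhd k w \<Longrightarrow> y \<in> nbhd k u \<Longrightarrow> y \<in> nbhd k w \<Longrightarrow> u \<noteq> w \<Longrightarrow> x = y"
  by (auto simp: mem_nbhd_iff dest: arg_cong[of _ _ length])

subsection \<open>RED:LD sets by neighbour counts\<close>

lemma card_ge_2_obtain:
  assumes "2 \<le> card A"
  obtains y where "y \<in> A" "y \<noteq> x"
proof -
  have "\<not> A \<subseteq> {x}"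
    using card_mono[of "{x}" A] assms by auto
  then show ?thesis using that by blast
qed

lemma LD_set_nbhd: "LD_set G T \<Longrightarrow> u \<in> pverts G \<Longrightarrow> u \<notin> T \<Longrightarrow> open_nbhd G u \<inter> T \<noteq> {}"
  unfolding LD_set_def by blast

text \<open>Removing \<open>u\<close> from \<open>S\<close> leaves \<open>u\<close> in need of a
  neighbour; removing a sole dominator would leave \<open>u\<close> undominated. The
  \<open>of_bool\<close> term merges both cases into one count that can be summed over a
  ball.\<close>

lemma RED_LD_set_nbhd_card:
  assumes "RED_LD_set (kary_tree k) S" "u \<in> lists {..<k}"
  shows "2 \<le> card (nbhd k u \<inter> S) + of_bool (u \<in> S)"
proof (cases "u \<in> S")
  case True
  then have "nbhd k u \<inter> (S - {u}) \<noteq> {}"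
    using assms by (intro LD_set_nbhd) (auto simp: RED_LD_set_def)
  then have "0 < card (nbhd k u \<inter> S)"
    by (auto simp: card_gt_0_iff)
  then show ?thesis using True by simp
next
  case False
  then obtain x where x: "x \<in> nbhd k u \<inter> S"
    using assms LD_set_nbhd[of "kary_tree k" S u] by (auto simp: RED_LD_set_def)
  have "nbhd k u \<inter> (S - {x}) \<noteq> {}"
    using assms x False by (intro LD_set_nbhd) (auto simp: RED_LD_set_def)
  then obtain y where "y \<in> nbhd k u \<inter> S" "y \<noteq> x" by blast
  then have "card {x, y} \<le> card (nbhd k u \<inter> S)"
    using x by (intro card_mono) auto
  then show ?thesis using \<open>y \<noteq> x\<close> by simp
qed

text \<open>Losing one vertex \<open>x\<close> cannot merge the traces of two vertices outside
  \<open>S\<close>: they share at most one neighbour, so each needs a further one that only the loss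
  of \<open>x\<close> can hide, and \<open>x\<close> becomes a second common neighbour.\<close>

lemma RED_LD_setI:
  assumes S: "S \<subseteq> lists {..<k}"
    and card: "\<And>u. u \<in> lists {..<k} \<Longrightarrow> 2 \<le> card (nbhd k u \<inter> S) + of_bool (u \<in> S)"
  shows "RED_LD_set (kary_tree k) S"
proof -
  have two: "\<exists>y. y \<in> nbhd k u \<and> y \<in> S \<and> y \<noteq> x" if "u \<in> lists {..<k}" "u \<notin> S" for u x
    using card_ge_2_obtain[of "nbhd k u \<inter> S" x] card[OF that(1)] that(2) by auto
  have one: "\<exists>y. y \<in> nbhd k u \<and> y \<in> S \<and> y \<noteq> u" if "u \<in> S" for u
  proof -
    have "u \<in> lists {..<k}" using that S by blast
    from card[OF this] have "nbhd k u \<inter> S \<noteq> {}" using that by auto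
    then show ?thesis using no_loop by blast
  qed
  have sep_out: "nbhd k u \<inter> T \<noteq> nbhd k w \<inter> T"
    if a: "S - {x} \<subseteq> T" "u \<in> lists {..<k}" "w \<in> lists {..<k}" "u \<notin> S" "w \<notin> S" "u \<noteq> w" for T u w x
  proof
    assume eq: "nbhd k u \<inter> T = nbhd k w \<inter> T"
    obtain y where y: "y \<in> nbhd k u" "y \<in> S" "y \<noteq> x" using two[OF a(2,4)] by blast
    then have yw: "y \<in> nbhd k w" using eq a(1) by blast
    obtain z where z: "z \<in> nbhd k u" "z \<in> S" "z \<noteq> y" using two[OF a(2,4)] by blast
    obtain z' where z': "z' \<in> nbhd k w" "z' \<in> S" "z' \<noteq> y" using two[OF a(3,5)] by blast
    have "z = x" using z eq a(1) no_4_cycle[OF y(1) yw z(1) _ a(6)] by blast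
    moreover have "z' = x" using z' eq a(1) no_4_cycle[OF y(1) yw _ z'(1) a(6)] by blast
    ultimately show False using no_4_cycle[OF y(1) yw z(1) _ a(6)] z z' by blast
  qed
  have sep_in: "nbhd k x \<inter> T \<noteq> nbhd k w \<inter> T"
    if a: "S - {x} \<subseteq> T" "x \<in> S" "w \<in> lists {..<k}" "w \<notin> S" for T w x
  proof
    assume eq: "nbhd k x \<inter> T = nbhd k w \<inter> T"
    obtain y where y: "y \<in> nbhd k x" "y \<in> S" "y \<noteq> x" using one[OF a(2)] by blast
    then have yw: "y \<in> nbhd k w" using eq a(1) by blast
    obtain z where z: "z \<in> nbhd k w" "z \<in> S" "z \<noteq> y" using two[OF a(3,4)] by blast
    have "x \<noteq> w" using a by blast
    then have "z = x" using z eq a(1) no_4_cycle[OF y(1) yw _ z(1)] by blast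
    \<comment> \<open>Now \<open>w\<close> is adjacent to \<open>x\<close>, and \<open>y\<close> to
      both of them: a triangle.\<close>
    then show False using no_triangle[OF z(1) yw] y(1) nbhd_sym by blast
  qed
  \<comment> \<open>The range of \<open>T\<close> admits both \<open>S\<close> and
    \<open>S - {x}\<close>, the two cases of RED:LD.\<close>
  have LD: "LD_set (kary_tree k) T" if T: "T \<subseteq> S" "S - {x} \<subseteq> T" for T x
    unfolding LD_set_def
  proof (intro conjI ballI impI)
    show "T \<subseteq> pverts (kary_tree k)" using T S by simp
  next
    fix u v assume uv: "u \<in> pverts (kary_tree k) - T" "v \<in> pverts (kary_tree k) - T"
    show "nbhd k v \<inter> T \<noteq> {}"
    proof (cases "v \<in> S")
      case True
      then have "v = x" using T uv by blast
      then show ?thesis using one[OF True] T by blast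
    next
      case False
      then show ?thesis using two[of v x] T uv by auto
    qed
    assume ne: "u \<noteq> v"
    have "u \<in> S \<Longrightarrow> u = x" "v \<in> S \<Longrightarrow> v = x" using T uv by blast+
    then show "nbhd k v \<inter> T \<noteq> nbhd k u \<inter> T"
      using sep_out[OF T(2), of v u] sep_in[OF T(2), of u] sep_in[OF T(2), of v] uv ne
      by (metis DiffD1 pverts_kary_tree)
  qed
  show ?thesis
    unfolding RED_LD_set_def using LD[of S] LD by blast
qed

subsection \<open>Distances and balls\<close>

text \<open>Moving from \<open>u\<close> to a child decreases the distance to \<open>v\<close> iff the child is an ancestor of
  \<open>v\<close> or \<open>v\<close> itself, that is, a suffix of \<open>v\<close>.\<close>

primrec tree_dist :: "nat list \<Rightarrow> nat list \<Rightarrow> nat" where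
  "tree_dist v [] = length v"
| "tree_dist v (i # u) =
     (if suffix (i # u) v then length v - Suc (length u) else Suc (tree_dist v u))"

lemma tree_dist_suffix: "suffix u v \<Longrightarrow> tree_dist v u = length v - length u"
  by (cases u) auto

lemma tree_dist_Cons_suffix:
  assumes "suffix (i # u) v"
  shows "tree_dist v u = Suc (tree_dist v (i # u))"
proof -
  have "suffix u v" using assms by (rule suffix_ConsD)
  moreover have "Suc (length u) \<le> length v" using suffix_length_le[OF assms] by simp
  ultimately show ?thesis using assms tree_dist_suffix[of u v] by simp
qed

lemma tree_dist_self [simp]: "tree_dist v v = 0"
  by (simp add: tree_dist_suffix)

lemma tree_dist_eq_0_iff: "tree_dist v u = 0 \<longleftrightarrow> u = v"
proof
  assume 0: "tree_dist v u = 0"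
  have "suffix u v" using 0 by (cases u) (auto split: if_splits)
  moreover have "length u = length v"
    using 0 tree_dist_suffix[OF calculation] suffix_length_le[OF calculation] by simp
  ultimately show "u = v" by (auto simp: suffix_def)
qed simp

lemma tree_dist_nbhd:
  assumes "w \<in> nbhd k u"
  shows "tree_dist v w = Suc (tree_dist v u) \<or> tree_dist v u = Suc (tree_dist v w)"
proof -
  have "tree_dist v (i # t) = Suc (tree_dist v t) \<or> tree_dist v t = Suc (tree_dist v (i # t))" for i t
    using tree_dist_Cons_suffix[of i t v] by (cases "suffix (i # t) v") auto
  then show ?thesis using assms unfolding mem_nbhd_iff by blast
qed

lemma suffix_Cons_unique: "suffix (i # u) v \<Longrightarrow> suffix (j # u) v \<Longrightarrow> i = j"
  using suffix_same_cases[of "i # u" v "j # u"] by (auto simp: suffix_def)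

text \<open>This is the first step of the path from \<open>u\<close> to \<open>v\<close>: down if
  \<open>u\<close> is an ancestor of \<open>v\<close>, otherwise up to the parent.\<close>

lemma ex1_closer_nbr:
  assumes v: "v \<in> lists {..<k}" and u: "u \<in> lists {..<k}" and ne: "u \<noteq> v"
  shows "\<exists>!w. w \<in> nbhd k u \<and> tree_dist v w < tree_dist v u"
proof (cases "suffix u v")
  case True
  then obtain zs where zs: "v = zs @ u" by (auto simp: suffix_def)
  with ne have "zs \<noteq> []" by auto
  \<comment> \<open>Words grow at the front, so the last letter of \<open>zs\<close> selects the
    child of \<open>u\<close> on the way to \<open>v\<close>.\<close>
  then obtain ys i where ys: "zs = ys @ [i]" by (metis rev_exhaust)
  have suf: "suffix (i # u) v" using zs ys by (auto simp: suffix_def)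
  have i: "i # u \<in> nbhd k u" using v zs ys by (auto simp: mem_nbhd_iff)
  show ?thesis
  proof (rule ex1I[of _ "i # u"])
    show "i # u \<in> nbhd k u \<and> tree_dist v (i # u) < tree_dist v u"
      using i tree_dist_Cons_suffix[OF suf] by simp
  next
    fix w assume w: "w \<in> nbhd k u \<and> tree_dist v w < tree_dist v u"
    then consider j where "w = j # u" | j where "u = j # w" by (auto simp: mem_nbhd_iff)
    then show "w = i # u"
    proof cases
      case 1
      then have "suffix (j # u) v" using w by (auto split: if_splits)
      then show ?thesis using 1 suffix_Cons_unique[OF _ suf] by simp
    next
      case 2
      then show ?thesis using w True tree_dist_Cons_suffix[of j w v] by simp
    qed
  qed
next
  case False
  then obtain j t where jt: "u = j # t" by (cases u) auto
  show ?thesis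
  proof (rule ex1I[of _ t])
    show "t \<in> nbhd k u \<and> tree_dist v t < tree_dist v u"
      using u jt False by (auto simp: mem_nbhd_iff)
  next
    fix w assume w: "w \<in> nbhd k u \<and> tree_dist v w < tree_dist v u"
    have "\<not> suffix (i # u) v" for i using False suffix_ConsD[of i u v] by auto
    then show "w = t" using w jt by (auto simp: mem_nbhd_iff)
  qed
qed

text \<open>Each arc changes \<open>tree_dist v\<close> by one, so walks are no shorter than it;
  repeatedly choosing the closer neighbour gives a walk of exactly that length.\<close>

lemma graph_ball_kary_tree:
  assumes v: "v \<in> lists {..<k}"
  shows "graph_ball (kary_tree k) v r = {u \<in> lists {..<k}. tree_dist v u \<le> r}"
proof -
  have parcs: "(u, w) \<in> parcs (kary_tree k) \<longleftrightarrow> w \<in> nbhd k u" for u w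
    by (simp add: open_nbhd_def)
  have "tree_dist v u \<le> n" if "(v, u) \<in> parcs (kary_tree k) ^^ n" for u n
    using that
  proof (induction n arbitrary: u)
    case (Suc n)
    then obtain w where w: "(v, w) \<in> parcs (kary_tree k) ^^ n" "u \<in> nbhd k w"
      by (auto simp: parcs)
    show ?case using Suc.IH[OF w(1)] tree_dist_nbhd[OF w(2), of v] by auto
  qed auto
  moreover have "(v, u) \<in> parcs (kary_tree k) ^^ tree_dist v u" if "u \<in> lists {..<k}" for u
    using that
  proof (induction "tree_dist v u" arbitrary: u)
    case 0
    then show ?case using tree_dist_eq_0_iff[of v u] by simp
  next
    case (Suc n)
    then have "u \<noteq> v" by auto
    then obtain w where w: "w \<in> nbhd k u" "tree_dist v w < tree_dist v u"
      using ex1_closer_nbr[OF v Suc.prems] by blast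
    then have n: "tree_dist v w = n" using tree_dist_nbhd[OF w(1), of v] Suc.hyps(2) by auto
    then have "(v, w) \<in> parcs (kary_tree k) ^^ n"
      using Suc.hyps(1)[of w] w(1) nbhd_subset by blast
    moreover have "(w, u) \<in> parcs (kary_tree k)" using w(1) nbhd_sym parcs by blast
    ultimately show ?case unfolding Suc.hyps(2)[symmetric] by auto
  qed
  ultimately show ?thesis
    unfolding graph_ball_def by (fastforce intro: order_trans)
qed

abbreviation tree_ball :: "nat \<Rightarrow> nat list \<Rightarrow> nat \<Rightarrow> nat list set" where
  "tree_ball k v r \<equiv> {u \<in> lists {..<k}. tree_dist v u \<le> r}"

lemma length_le_tree_dist: "length u \<le> length v + tree_dist v u"
  by (induction u) (auto dest: suffix_length_le)

lemma finite_tree_ball [simp]: "finite (tree_ball k v r)"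
proof (rule finite_subset)
  show "tree_ball k v r \<subseteq> {u. set u \<subseteq> {..<k} \<and> length u \<le> length v + r}"
    using length_le_tree_dist[of _ v] by (fastforce intro: order_trans)
qed (simp add: finite_lists_length_le)

text \<open>The descendants of \<open>v\<close> exactly \<open>r\<close> levels below it already
  suffice.\<close>

lemma card_tree_ball_ge:
  assumes v: "v \<in> lists {..<k}"
  shows "k ^ r \<le> card (tree_ball k v r)"
proof -
  have "tree_dist v (w @ v) \<le> length w" for w
    by (induction w) auto
  then have "(\<lambda>w. w @ v) ` {w. set w \<subseteq> {..<k} \<and> length w = r} \<subseteq> tree_ball k v r"
    using v by fastforce
  then have "card ((\<lambda>w. w @ v) ` {w. set w \<subseteq> {..<k} \<and> length w = r}) \<le> card (tree_ball k v r)"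
    by (intro card_mono) auto
  then show ?thesis
    by (simp add: card_image inj_on_def card_lists_length_eq)
qed

subsection \<open>Counting edges across a ball\<close>

text \<open>Double counting of adjacent pairs: an \<open>x\<close> within distance \<open>r\<close>
  has all its neighbours in the ball of radius \<open>Suc r\<close>, while one at distance
  \<open>r + 1\<close> or \<open>r + 2\<close> has only its closer neighbour there. Adding a term on
  the left avoids subtraction on \<open>nat\<close>.\<close>

lemma sum_nbhd_ball:
  assumes v: "v \<in> lists {..<k}"
  shows "(\<Sum>u\<in>tree_ball k v (Suc r). card (nbhd k u \<inter> S)) + card (S \<inter> tree_ball k v r)
       = (\<Sum>x\<in>S \<inter> tree_ball k v r. card (nbhd k x)) + card (S \<inter> tree_ball k v (r + 2))"
proof -
  let ?B = "tree_ball k v"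
  have nb: "nbhd k u \<inter> S = {x \<in> S \<inter> ?B (r + 2). x \<in> nbhd k u}" if "u \<in> ?B (Suc r)" for u
    using that nbhd_subset tree_dist_nbhd[of _ k u v] by fastforce
  have "(\<Sum>u\<in>?B (Suc r). card (nbhd k u \<inter> S))
      = (\<Sum>u\<in>?B (Suc r). card {x \<in> S \<inter> ?B (r + 2). x \<in> nbhd k u})"
    by (intro sum.cong refl) (simp only: nb)
  also have "\<dots> = (\<Sum>x\<in>S \<inter> ?B (r + 2). card {u \<in> ?B (Suc r). x \<in> nbhd k u})"
    using sum.swap_restrict[of "?B (Suc r)" "S \<inter> ?B (r + 2)" "\<lambda>_ _. 1::nat" "\<lambda>u x. x \<in> nbhd k u"]
    by simp
  also have "\<dots> = (\<Sum>x\<in>S \<inter> ?B r. card {u \<in> ?B (Suc r). x \<in> nbhd k u})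
      + (\<Sum>x\<in>S \<inter> ?B (r + 2) - S \<inter> ?B r. card {u \<in> ?B (Suc r). x \<in> nbhd k u})"
    by (subst sum.subset_diff[of "S \<inter> ?B r"]) auto
  also have "(\<Sum>x\<in>S \<inter> ?B r. card {u \<in> ?B (Suc r). x \<in> nbhd k u})
      = (\<Sum>x\<in>S \<inter> ?B r. card (nbhd k x))"
  proof (intro sum.cong refl arg_cong[where f = card])
    fix x assume "x \<in> S \<inter> ?B r"
    then show "{u \<in> ?B (Suc r). x \<in> nbhd k u} = nbhd k x"
      using nbhd_subset nbhd_sym tree_dist_nbhd[of _ k x v] by fastforce
  qed
  also have "(\<Sum>x\<in>S \<inter> ?B (r + 2) - S \<inter> ?B r. card {u \<in> ?B (Suc r). x \<in> nbhd k u})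
      = (\<Sum>x\<in>S \<inter> ?B (r + 2) - S \<inter> ?B r. 1)"
  proof (intro sum.cong refl)
    fix x assume x: "x \<in> S \<inter> ?B (r + 2) - S \<inter> ?B r"
    then have d: "x \<in> lists {..<k}" "r < tree_dist v x" "tree_dist v x \<le> r + 2" by auto
    then have "x \<noteq> v" by auto
    then obtain w where w: "w \<in> nbhd k x" "tree_dist v w < tree_dist v x"
      "\<And>y. y \<in> nbhd k x \<Longrightarrow> tree_dist v y < tree_dist v x \<Longrightarrow> y = w"
      using ex1_closer_nbr[OF v d(1)] by blast
    have "u \<in> ?B (Suc r) \<and> x \<in> nbhd k u \<longleftrightarrow> u = w" for u
    proof
      assume u: "u \<in> ?B (Suc r) \<and> x \<in> nbhd k u"
      then have "u \<in> nbhd k x" using nbhd_sym by blast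
      then show "u = w" using w(3)[of u] tree_dist_nbhd[of u k x v] u d by auto
    next
      assume "u = w"
      then show "u \<in> ?B (Suc r) \<and> x \<in> nbhd k u"
        using w(1,2) d(3) nbhd_sym[of w k x] nbhd_subset[of k x] by auto
    qed
    then have "{u \<in> ?B (Suc r). x \<in> nbhd k u} = {w}" by blast
    then show "card {u \<in> ?B (Suc r). x \<in> nbhd k u} = 1" by simp
  qed
  also have "(\<Sum>x\<in>S \<inter> ?B (r + 2) - S \<inter> ?B r. 1) = card (S \<inter> ?B (r + 2)) - card (S \<inter> ?B r)"
    by (subst card_Diff_subset[symmetric]) auto
  finally have "(\<Sum>u\<in>?B (Suc r). card (nbhd k u \<inter> S))
      = (\<Sum>x\<in>S \<inter> ?B r. card (nbhd k x)) + (card (S \<inter> ?B (r + 2)) - card (S \<inter> ?B r))" .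
  moreover have "card (S \<inter> ?B r) \<le> card (S \<inter> ?B (r + 2))"
    by (intro card_mono) auto
  ultimately show ?thesis by linarith
qed

lemma sum_card_nbhd:
  assumes "finite A" "A \<subseteq> lists {..<k}"
  shows "(\<Sum>x\<in>A. card (nbhd k x)) + of_bool ([] \<in> A) = (k + 1) * card A"
proof -
  have "(\<Sum>x\<in>A. card (nbhd k x)) + (\<Sum>x\<in>A. of_bool (x = [])) = (\<Sum>x\<in>A. k + 1)"
    unfolding sum.distrib[symmetric] using assms(2) by (intro sum.cong refl card_nbhd) auto
  moreover have "(\<Sum>x\<in>A. of_bool (x = [])) = (of_bool ([] \<in> A) :: nat)"
    using assms(1) by (simp add: of_bool_def)
  ultimately show ?thesis by simp
qed

lemma sum_of_bool_card:
  "finite B \<Longrightarrow> (\<Sum>u\<in>B. of_bool (u \<in> S)) = card (S \<inter> B)"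
  by (simp add: Int_commute)

lemma ball_count_ge:
  assumes v: "v \<in> lists {..<k}"
    and card: "\<And>u. u \<in> lists {..<k} \<Longrightarrow> 2 \<le> card (nbhd k u \<inter> S) + of_bool (u \<in> S)"
  shows "2 * card (tree_ball k v (Suc r))
    \<le> card (S \<inter> tree_ball k v (r + 2)) + card (S \<inter> tree_ball k v (Suc r))
      + k * card (S \<inter> tree_ball k v r)"
proof -
  let ?B = "tree_ball k v"
  have "(\<Sum>u\<in>?B (Suc r). 2) \<le> (\<Sum>u\<in>?B (Suc r). card (nbhd k u \<inter> S) + of_bool (u \<in> S))"
    using card by (intro sum_mono) auto
  then have "2 * card (?B (Suc r)) \<le> (\<Sum>u\<in>?B (Suc r). card (nbhd k u \<inter> S)) + card (S \<inter> ?B (Suc r))"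
    by (simp only: sum.distrib sum_of_bool_card finite_tree_ball) simp
  moreover have "(\<Sum>x\<in>S \<inter> ?B r. card (nbhd k x)) \<le> (k + 1) * card (S \<inter> ?B r)"
    by (subst sum_card_nbhd[symmetric]) auto
  ultimately show ?thesis
    using sum_nbhd_ball[OF v, where r = r and S = S] by (simp add: algebra_simps)
qed

text \<open>With the root outside \<open>S\<close>, every vertex of \<open>S\<close> has degree
  exactly \<open>k + 1\<close>, so no inequality remains in the count.\<close>

lemma ball_count_eq:
  assumes v: "v \<in> lists {..<k}" and root: "[] \<notin> S"
    and card: "\<And>u. u \<in> lists {..<k} \<Longrightarrow> card (nbhd k u \<inter> S) + of_bool (u \<in> S) = 2"
  shows "card (S \<inter> tree_ball k v (r + 2)) + card (S \<inter> tree_ball k v (Suc r))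
      + k * card (S \<inter> tree_ball k v r) = 2 * card (tree_ball k v (Suc r))"
proof -
  let ?B = "tree_ball k v"
  have "(\<Sum>u\<in>?B (Suc r). card (nbhd k u \<inter> S) + of_bool (u \<in> S)) = (\<Sum>u\<in>?B (Suc r). 2)"
    using card by (intro sum.cong) auto
  then have "(\<Sum>u\<in>?B (Suc r). card (nbhd k u \<inter> S)) + card (S \<inter> ?B (Suc r)) = 2 * card (?B (Suc r))"
    by (simp only: sum.distrib sum_of_bool_card finite_tree_ball) simp
  moreover have "(\<Sum>x\<in>S \<inter> ?B r. card (nbhd k x)) = (k + 1) * card (S \<inter> ?B r)"
    using sum_card_nbhd[of "S \<inter> ?B r" k] root by auto
  ultimately show ?thesis
    using sum_nbhd_ball[OF v, where r = r and S = S] by (simp add: algebra_simps)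
qed

text \<open>The double count is applied to all vertices. As \<open>tree_dist v []\<close> is
  \<open>length v\<close>, the root lies in both balls and its missing parent cancels.\<close>

lemma card_tree_ball_rec:
  assumes v: "v \<in> lists {..<k}" and r: "length v \<le> r"
  shows "card (tree_ball k v (r + 2)) + k * card (tree_ball k v r)
    = (k + 1) * card (tree_ball k v (Suc r))"
proof -
  let ?B = "tree_ball k v"
  have N: "nbhd k u \<inter> lists {..<k} = nbhd k u" for u using nbhd_subset by blast
  have L: "lists {..<k} \<inter> ?B n = ?B n" for n by blast
  have root: "[] \<in> ?B r" "[] \<in> ?B (Suc r)" using r by auto
  have "(\<Sum>u\<in>?B (Suc r). card (nbhd k u)) + card (?B r)
      = (\<Sum>x\<in>?B r. card (nbhd k x)) + card (?B (r + 2))"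
    using sum_nbhd_ball[OF v, where r = r and S = "lists {..<k}"] by (simp only: N L)
  moreover have "(\<Sum>x\<in>?B n. card (nbhd k x)) + of_bool ([] \<in> ?B n) = (k + 1) * card (?B n)" for n
    by (rule sum_card_nbhd) auto
  from this[of r] this[of "Suc r"] have
    "(\<Sum>x\<in>?B r. card (nbhd k x)) + 1 = (k + 1) * card (?B r)"
    "(\<Sum>x\<in>?B (Suc r). card (nbhd k x)) + 1 = (k + 1) * card (?B (Suc r))"
    by (simp_all only: root of_bool_eq simp_thms)
  ultimately show ?thesis by (simp add: algebra_simps)
qed

subsection \<open>The two bounds\<close>

definition excess :: "nat \<Rightarrow> nat list \<Rightarrow> nat list set \<Rightarrow> nat \<Rightarrow> real" where
  "excess k v S r =
     real (card (S \<inter> tree_ball k v r)) - 2 / (real k + 2) * real (card (tree_ball k v r))"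

text \<open>Adding one more \<open>?b (Suc r)\<close> to the ball recurrence yields
  \<open>(k + 2) * ?b (Suc r)\<close>; the factor \<open>2 / (k + 2)\<close> turns this into the
  \<open>2 * ?b (Suc r)\<close> of the counting bound.\<close>

lemma excess_step:
  assumes v: "v \<in> lists {..<k}" and r: "length v \<le> r"
  shows "excess k v S (r + 2) + excess k v S (Suc r) + k * excess k v S r
    = real (card (S \<inter> tree_ball k v (r + 2)) + card (S \<inter> tree_ball k v (Suc r))
      + k * card (S \<inter> tree_ball k v r)) - real (2 * card (tree_ball k v (Suc r)))"
proof -
  let ?b = "\<lambda>n. real (card (tree_ball k v n))"
  have "?b (r + 2) + real k * ?b r = (real k + 1) * ?b (Suc r)"
    using arg_cong[OF card_tree_ball_rec[OF v r], of real]
    by (simp only: of_nat_add of_nat_mult of_nat_1)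
  then have "?b (r + 2) + ?b (Suc r) + k * ?b r = (real k + 2) * ?b (Suc r)"
    by (simp add: algebra_simps)
  then have "2 / (real k + 2) * (?b (r + 2) + ?b (Suc r) + k * ?b r) = 2 * ?b (Suc r)"
    by simp
  then show ?thesis
    unfolding excess_def by (simp add: algebra_simps)
qed

lemma card_tree_ball_pos:
  assumes "k \<ge> 2" "v \<in> lists {..<k}"
  shows "0 < card (tree_ball k v r)"
proof -
  have "0 < k ^ r" using assms(1) by simp
  then show ?thesis using card_tree_ball_ge[OF assms(2), of r] by linarith
qed

lemma density_ge:
  assumes k: "k \<ge> 2" and v: "v \<in> lists {..<k}" and S: "RED_LD_set (kary_tree k) S"
  shows "ereal (2 / (real k + 2)) \<le> density_at (kary_tree k) v S"
proof (rule ccontr)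
  assume "\<not> ?thesis"
  then have "limsup (\<lambda>r. ereal (real (card (S \<inter> tree_ball k v r)) / real (card (tree_ball k v r))))
      < ereal (2 / (real k + 2))"
    unfolding density_at_def graph_ball_kary_tree[OF v] by simp
  then have "\<forall>\<^sub>F r in sequentially.
      ereal (real (card (S \<inter> tree_ball k v r)) / real (card (tree_ball k v r)))
      < ereal (2 / (real k + 2))"
    by (rule Limsup_lessD)
  then have "\<forall>\<^sub>F r in sequentially. excess k v S r < 0"
  proof eventually_elim
    case (elim r)
    then have "real (card (S \<inter> tree_ball k v r)) / real (card (tree_ball k v r)) < 2 / (real k + 2)"
      by simp
    then show ?case
      unfolding excess_def using card_tree_ball_pos[OF k v, of r]
      by (simp only: pos_divide_less_eq of_nat_0_less_iff)
  qed
  then obtain N where N: "\<And>r. r \<ge> N \<Longrightarrow> excess k v S r < 0"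
    by (auto simp: eventually_sequentially)
  \<comment> \<open>Large enough for three consecutive negative values and for the ball
    recurrence.\<close>
  define r where "r = max N (length v)"
  have "excess k v S (r + 2) < 0" "excess k v S (Suc r) < 0" "excess k v S r < 0"
    using N by (auto simp: r_def)
  moreover from this have "k * excess k v S r \<le> 0" by (simp add: mult_nonneg_nonpos)
  moreover have "0 \<le> excess k v S (r + 2) + excess k v S (Suc r) + k * excess k v S r"
    using ball_count_ge[OF v RED_LD_set_nbhd_card[OF S], of r]
    by (subst excess_step[OF v]) (auto simp: r_def simp del: of_nat_add of_nat_mult)
  ultimately show False by linarith
qed

text \<open>The form \<open>Q\<close> in the proof is the homogenised characteristic polynomial of the recurrence;
  each step of the recurrence multiplies it by \<open>k\<close>.\<close>

lemma recurrence_square_bound: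
  fixes f :: "nat \<Rightarrow> real" and k :: real
  assumes k: "k \<ge> 2" and rec: "\<And>r. r \<ge> m \<Longrightarrow> f (r + 2) + f (Suc r) + k * f r = 0"
  shows "\<exists>C. \<forall>r\<ge>m. (f r)\<^sup>2 \<le> C * k ^ r"
proof -
  define Q where "Q r = (f (Suc r))\<^sup>2 + f (Suc r) * f r + k * (f r)\<^sup>2" for r
  have step: "Q (Suc r) = k * Q r" if "r \<ge> m" for r
  proof -
    have f: "f (Suc (Suc r)) = - f (Suc r) - k * f r" using rec[OF that] by simp
    show ?thesis unfolding Q_def f by (simp add: power2_eq_square algebra_simps)
  qed
  have Q: "Q r = Q m / k ^ m * k ^ r" if "r \<ge> m" for r
    using that
  proof (induction r rule: dec_induct)
    case base
    then show ?case using k by simp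
  next
    case (step n)
    then show ?case using \<open>\<And>r. r \<ge> m \<Longrightarrow> Q (Suc r) = k * Q r\<close>[of n] by simp
  qed
  have "(f r)\<^sup>2 \<le> Q r" for r
  proof -
    \<comment> \<open>Completing the square costs \<open>1/4\<close>, and the subtracted square
      costs \<open>1\<close>, hence \<open>5/4\<close>.\<close>
    have "Q r - (f r)\<^sup>2 = (f (Suc r) + f r / 2)\<^sup>2 + (k - 5/4) * (f r)\<^sup>2"
      unfolding Q_def by (simp add: power2_eq_square algebra_simps)
    moreover have "0 \<le> (k - 5/4) * (f r)\<^sup>2" using k by (intro mult_nonneg_nonneg) auto
    moreover have "0 \<le> (f (Suc r) + f r / 2)\<^sup>2" by simp
    ultimately show ?thesis by linarith
  qed
  then show ?thesis using Q by metis
qed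

text \<open>The squared excess is of order at most \<open>k ^ r\<close>, the squared ball size at
  least \<open>k ^ (2 * r)\<close>, so their ratio tends to zero. The limit superior is thus a
  genuine limit.\<close>

lemma density_eq:
  assumes k: "k \<ge> 2" and v: "v \<in> lists {..<k}" and root: "[] \<notin> S"
    and card: "\<And>u. u \<in> lists {..<k} \<Longrightarrow> card (nbhd k u \<inter> S) + of_bool (u \<in> S) = 2"
  shows "density_at (kary_tree k) v S = ereal (2 / (real k + 2))"
proof -
  let ?b = "\<lambda>n. real (card (tree_ball k v n))"
  have "excess k v S (r + 2) + excess k v S (Suc r) + real k * excess k v S r = 0"
    if "r \<ge> length v" for r
    by (simp only: excess_step[OF v that] ball_count_eq[OF v root card] diff_self)
  then obtain C where C: "\<And>r. r \<ge> length v \<Longrightarrow> (excess k v S r)\<^sup>2 \<le> C * real k ^ r"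
    using recurrence_square_bound[of "real k" "length v" "excess k v S"] k by auto
  have bound: "(excess k v S r / ?b r)\<^sup>2 \<le> C * (1 / real k) ^ r" if r: "r \<ge> length v" for r
  proof -
    have kr: "0 < real k ^ r" using k by simp
    have "real k ^ r \<le> ?b r"
      using card_tree_ball_ge[OF v, of r] by (metis of_nat_le_iff of_nat_power)
    then have "(real k ^ r)\<^sup>2 \<le> (?b r)\<^sup>2" using kr by (intro power_mono) auto
    then have "(excess k v S r)\<^sup>2 / (?b r)\<^sup>2 \<le> (C * real k ^ r) / (real k ^ r)\<^sup>2"
      \<comment> \<open>The numerator \<open>C * k ^ r\<close> is nonnegative because it bounds a
        square.\<close>
      using C[OF r] kr by (intro frac_le) (auto intro: order_trans[OF zero_le_power2])
    also have "\<dots> = C * (1 / real k) ^ r"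
      using kr by (simp add: power2_eq_square power_one_over field_simps)
    finally show ?thesis by (simp add: power_divide)
  qed
  have upper_lim: "(\<lambda>r. C * (1 / real k) ^ r) \<longlonglongrightarrow> 0"
    using k by (intro tendsto_mult_right_zero LIMSEQ_power_zero) auto
  have upper: "\<forall>\<^sub>F r in sequentially. (excess k v S r / ?b r)\<^sup>2 \<le> C * (1 / real k) ^ r"
    using bound by (rule eventually_sequentiallyI)
  have lower: "\<forall>\<^sub>F r in sequentially. 0 \<le> (excess k v S r / ?b r)\<^sup>2"
    by (rule always_eventually) (rule allI, rule zero_le_power2)
  have "(\<lambda>r. (excess k v S r / ?b r)\<^sup>2) \<longlonglongrightarrow> 0"
    by (rule tendsto_sandwich[OF lower upper tendsto_const upper_lim])
  then have "(\<lambda>r. sqrt ((excess k v S r / ?b r)\<^sup>2)) \<longlonglongrightarrow> sqrt 0"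
    by (rule tendsto_real_sqrt)
  then have "(\<lambda>r. excess k v S r / ?b r) \<longlonglongrightarrow> 0"
    by (simp only: real_sqrt_abs real_sqrt_zero tendsto_rabs_zero_iff)
  then have "(\<lambda>r. excess k v S r / ?b r + 2 / (real k + 2)) \<longlonglongrightarrow> 0 + 2 / (real k + 2)"
    by (intro tendsto_add tendsto_const)
  moreover have "excess k v S r / ?b r + 2 / (real k + 2)
      = real (card (S \<inter> tree_ball k v r)) / ?b r" for r
    using card_tree_ball_pos[OF k v, of r]
    by (auto simp: excess_def diff_divide_distrib card_gt_0_iff)
  ultimately have "(\<lambda>r. real (card (S \<inter> tree_ball k v r)) / ?b r) \<longlonglongrightarrow> 2 / (real k + 2)"
    by simp
  then have "(\<lambda>r. ereal (real (card (S \<inter> tree_ball k v r)) / ?b r)) \<longlonglongrightarrow> ereal (2 / (real k + 2))"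
    by simp
  then show ?thesis
    unfolding density_at_def graph_ball_kary_tree[OF v] by (intro lim_imp_Limsup) auto
qed

subsection \<open>An optimal set\<close>

text \<open>Top-down: a vertex gets exactly as many children in the set as it needs after its parent
  has been taken into account.\<close>

fun in_opt :: "nat list \<Rightarrow> bool" where
  "in_opt [] = False"
| "in_opt [i] = (i < 2)"
| "in_opt (i # j # u) = (i < 2 - of_bool (in_opt (j # u)) - of_bool (in_opt u))"

lemma card_nbhd_in_opt:
  assumes k: "k \<ge> 2" and u: "u \<in> lists {..<k}"
  shows "card (nbhd k u \<inter> {w \<in> lists {..<k}. in_opt w}) + of_bool (u \<in> {w \<in> lists {..<k}. in_opt w})
    = 2"
proof (cases u)
  case Nil
  have "nbhd k [] \<inter> {w \<in> lists {..<k}. in_opt w} = (\<lambda>i. [i]) ` {..<2}"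
    using k by (auto simp: nbhd_Nil)
  then show ?thesis using Nil by (simp add: card_image inj_on_def)
next
  case (Cons j t)
  \<comment> \<open>The demand of \<open>u\<close> left after counting itself and its parent
    \<open>t\<close>; it is at most \<open>2\<close>, so \<open>k\<close> children can meet
    it.\<close>
  define n where "n = (2 - of_bool (in_opt u) - of_bool (in_opt t) :: nat)"
  have n: "n \<le> k" using k by (simp add: n_def)
  have "nbhd k u \<inter> {w \<in> lists {..<k}. in_opt w}
      = (\<lambda>i. i # u) ` {..<n} \<union> (if in_opt t then {t} else {})"
    using n u unfolding Cons nbhd_Cons[OF u[unfolded Cons]] by (auto simp: n_def Cons)
  moreover have "(\<lambda>i. i # u) ` {..<n} \<inter> (if in_opt t then {t} else {}) = {}"
    using Cons by (auto dest: arg_cong[of _ _ length])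
  ultimately have "card (nbhd k u \<inter> {w \<in> lists {..<k}. in_opt w}) = n + of_bool (in_opt t)"
    by (simp add: card_Un_disjoint card_image inj_on_def)
  then show ?thesis using u by (simp add: n_def)
qed

theorem theorem16:
  fixes k :: nat and v :: "nat list"
  assumes "k \<ge> 2"
    and "v \<in> pverts (kary_tree k)"
  shows "(\<exists>S. RED_LD_set (kary_tree k) S \<and> density_at (kary_tree k) v S = ereal (2 / (real k + 2)))
    \<and> (\<forall>S. RED_LD_set (kary_tree k) S \<longrightarrow> ereal (2 / (real k + 2)) \<le> density_at (kary_tree k) v S)"
proof (intro conjI exI allI impI)
  \<comment> \<open>The witness does not depend on the centre \<open>v\<close>, so one set is
    optimal for all centres.\<close>
  let ?S = "{w \<in> lists {..<k}. in_opt w}"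
  have v: "v \<in> lists {..<k}" using assms(2) by simp
  show "RED_LD_set (kary_tree k) ?S"
    by (rule RED_LD_setI) (auto simp only: card_nbhd_in_opt[OF assms(1)])
  show "density_at (kary_tree k) v ?S = ereal (2 / (real k + 2))"
    by (rule density_eq[OF assms(1) v]) (simp_all only: card_nbhd_in_opt[OF assms(1)], simp)
  show "ereal (2 / (real k + 2)) \<le> density_at (kary_tree k) v S"
    if "RED_LD_set (kary_tree k) S" for S
    using density_ge[OF assms(1) v that] .
qed

end
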